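(* Let $q$ be a prime power and let $\phi\in\mathrm{PGL}(2,q)\setminus\mathrm{AGL}(1,q)$ be a non-affine transformation, i.e. $\phi(x)=\frac{ax+b}{cx+d}$ with $a,b,c,d\in\mathbb{F}_q$, $c\ne0$, $ad-bc\neq0$, and suppose that the order of $\phi$ is $r+1$. Let $\phi^i=\underbrace{\phi\circ\cdots\circ\phi}_{i}$ (with $\phi^0=x$), and define $$h(x)=\sum_{i=0}^{r}\phi^{i}(x)\in\mathbb{F}_q(x).$$ Then $\deg(h)=r+1$, and the fixed field of the cyclic subgroup $\langle\phi\rangle$ is precisely $\mathbb{F}_q(h(x))$. In particular, the extension $\mathbb{F}_q(x)/\mathbb{F}_q(h(x))$ is Galois.
   Context: $\mathrm{PGL}(2,q)$ is identified with the group of linear fractional transformations $\frac{ax+b}{cx+d}$ over $\mathbb{F}_q$ ($ad-bc\ne0$), and acts on $\mathbb{F}_q(x)$ by composition: $\phi\cdot u=u\circ\phi$ for $u\in\mathbb{F}_q(x)$. $\mathrm{AGL}(1,q)$ is the subgroup of affine maps ($c=0$). The fixed field of a subgroup $H$ is $\{u\in\mathbb{F}_q(x): u\circ\psi=u \text{ for all }\psi\in H\}$. For a rational function written as $f/g$ with $f,g$ coprime polynomials, its degree is $\max\{\deg f,\deg g\}$. *)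

theory Defs
  imports
    "HOL-Algebra.Generated_Groups"
    "HOL-Algebra.Generated_Fields"
    "HOL-Algebra.Algebraic_Closure_Type"
    "HOL-Computational_Algebra.Polynomial_Factorial"
begin

section \<open>Rational functions over a field\<close>

type_synonym 'a ratfun = "'a poly fract"

definition reduced_form :: "'a::field ratfun \<Rightarrow> 'a poly \<Rightarrow> 'a poly \<Rightarrow> bool" where
  "reduced_form u f g \<longleftrightarrow> g \<noteq> 0 \<and> coprime f g \<and> u = Fract f g"

definition rf_degree :: "'a::field ratfun \<Rightarrow> nat" where
  "rf_degree u =
     (THE n. \<exists>f g. reduced_form u f g \<and> n = max (Polynomial.degree f) (Polynomial.degree g))"

definition rf_const :: "'a::field \<Rightarrow> 'a ratfun" where
  "rf_const c = to_fract [:c:]"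

definition rf_X :: "'a::field ratfun" where
  "rf_X = to_fract [:0, 1:]"

definition poly_at :: "'a::field poly \<Rightarrow> 'a ratfun \<Rightarrow> 'a ratfun" where
  "poly_at f v = poly (map_poly rf_const f) v"

text \<open>
  Composition \<open>u \<circ> v\<close>. If \<open>v\<close> is a constant at which \<open>u\<close> has a pole, the value is \<open>0\<close> by the
  convention \<open>x / 0 = 0\<close>; this case does not occur when \<open>v\<close> is a linear fractional transformation.
\<close>
definition rf_comp :: "'a::field ratfun \<Rightarrow> 'a ratfun \<Rightarrow> 'a ratfun" where
  "rf_comp u v = (THE w. \<exists>f g. reduced_form u f g \<and> w = poly_at f v / poly_at g v)"


section \<open>Linear fractional transformations\<close>

definition lin_frac :: "'a::field \<Rightarrow> 'a \<Rightarrow> 'a \<Rightarrow> 'a \<Rightarrow> 'a ratfun" where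
  "lin_frac a b c d = Fract [:b, a:] [:d, c:]"

definition PGL2 :: "'a::field ratfun monoid" where
  "PGL2 = \<lparr> carrier = {lin_frac a b c d | a b c d. a * d - b * c \<noteq> 0},
            monoid.mult = rf_comp, one = rf_X \<rparr>"

definition AGL1 :: "'a::field ratfun set" where
  "AGL1 = {lin_frac a b c d | a b c d. a * d - b * c \<noteq> 0 \<and> c = 0}"


lemma rf_const_hom:
  "rf_const 0 = 0" "rf_const 1 = 1" "rf_const (a + b) = rf_const a + rf_const b"
  "rf_const (a * b) = rf_const a * rf_const b" "rf_const (- a) = - rf_const a"
  "rf_const a = 0 \<longleftrightarrow> a = 0"
  unfolding rf_const_def by (simp_all flip: to_fract_add to_fract_mult to_fract_uminus add: one_pCons[symmetric])

lemma poly_at_pCons [simp]: "poly_at (pCons a f) v = rf_const a + v * poly_at f v"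
  by (cases "a = 0 \<and> f = 0") (auto simp: poly_at_def map_poly_pCons rf_const_hom)

lemma poly_at_0 [simp]: "poly_at 0 v = 0"
  by (simp add: poly_at_def)

lemma poly_at_add [simp]: "poly_at (f + g) v = poly_at f v + poly_at g v"
proof (induction f g rule: poly_induct2)
  case (pCons a p b q)
  then show ?case by (simp add: rf_const_hom algebra_simps)
qed simp

lemma poly_at_smult [simp]: "poly_at (smult c f) v = rf_const c * poly_at f v"
  by (induction f) (simp_all add: rf_const_hom algebra_simps)

lemma poly_at_mult [simp]: "poly_at (f * g) v = poly_at f v * poly_at g v"
  by (induction f) (simp_all add: rf_const_hom algebra_simps)

lemma coprime_bezout:
  fixes f g :: "'a::field poly"
  assumes "coprime f g"
  shows "\<exists>s t. s * f + t * g = 1"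
  using assms
proof (induction "if g = 0 then 0 else Suc (Polynomial.degree g)" arbitrary: f g rule: less_induct)
  case less
  show ?case
  proof (cases "g = 0")
    case True
    then show ?thesis using less.prems by (auto elim!: dvdE) (metis mult.commute)
  next
    case False
    have eq: "f = f div g * g + f mod g" by simp
    have "coprime g (f mod g)"
    proof (rule coprimeI)
      fix c assume c: "c dvd g" "c dvd f mod g"
      then have "c dvd f" using eq by (metis dvd_add dvd_mult)
      then show "is_unit c" using c less.prems by (meson coprime_common_divisor)
    qed
    moreover have "(if f mod g = 0 then 0 else Suc (Polynomial.degree (f mod g))) <
        (if g = 0 then 0 else Suc (Polynomial.degree g))"
      using degree_mod_less[of g f] False by auto
    ultimately obtain s t where st: "s * g + t * (f mod g) = 1" using less.hyps by blast
    have "t * f + (s - t * (f div g)) * g = s * g + t * (f - f div g * g)"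
      by (simp add: algebra_simps)
    also have "f - f div g * g = f mod g" by (rule minus_div_mult_eq_mod)
    finally show ?thesis using st by metis
  qed
qed

lemma coprime_dvd_cancel:
  fixes f g h :: "'a::field poly"
  assumes "coprime f g" "g dvd f * h"
  shows "g dvd h"
proof -
  obtain s t where st: "s * f + t * g = 1" using coprime_bezout assms(1) by blast
  have "h = (s * f + t * g) * h" using st by simp
  also have "\<dots> = s * (f * h) + g * (t * h)" by (simp add: algebra_simps)
  finally show ?thesis using assms(2) by (metis dvd_add dvd_mult dvd_triv_left)
qed

lemma reduced_form_unique:
  assumes "reduced_form u f g" "reduced_form u f' g'"
  shows "\<exists>c. c \<noteq> 0 \<and> f' = Polynomial.smult c f \<and> g' = Polynomial.smult c g"
proof -
  have nz: "g \<noteq> 0" "g' \<noteq> 0" and cop: "coprime f g" "coprime f' g'"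
    and "Fract f g = Fract f' g'"
    using assms unfolding reduced_form_def by metis+
  then have eq: "f * g' = f' * g" using eq_fract(1)[OF nz, of f f'] by blast
  have "g dvd g'" using cop(1) eq 
    by (metis coprime_dvd_cancel dvd_triv_right)
  moreover have "g' dvd g" using cop(2) eq[symmetric]
    by (metis coprime_dvd_cancel dvd_triv_right)
  ultimately obtain k l where kl: "g' = g * k" "g = g' * l" unfolding dvd_def by blast
  have "g * (k * l) = g * k * l" by (simp only: mult.assoc)
  also have "\<dots> = g' * l" by (simp only: kl(1))
  also have "\<dots> = g * 1" by (simp flip: kl(2))
  finally have "1 = k * l" using nz by (simp only: mult_cancel_left) simp
  then have "k dvd 1" by (rule dvdI)
  then obtain c where c: "k = [:c:]" "c \<noteq> 0"
    unfolding is_unit_poly_iff by (auto simp: dvd_field_iff)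
  have g': "g' = Polynomial.smult c g" using kl(1) c by simp
  then have "f' * g = Polynomial.smult c f * g" using eq by simp
  then have "f' = Polynomial.smult c f" using nz by (simp only: mult_cancel_right) simp
  with g' c show ?thesis by blast
qed

lemma rf_comp_eq:
  assumes "reduced_form u f g"
  shows "rf_comp u v = poly_at f v / poly_at g v"
  unfolding rf_comp_def
proof (rule the_equality)
  show "\<exists>f' g'. reduced_form u f' g' \<and> poly_at f v / poly_at g v = poly_at f' v / poly_at g' v"
    using assms by blast
qed (use reduced_form_unique[OF assms] in \<open>fastforce simp: rf_const_hom\<close>)

lemma rf_degree_eq:
  assumes "reduced_form u f g"
  shows "rf_degree u = max (Polynomial.degree f) (Polynomial.degree g)"
  unfolding rf_degree_def
proof (rule the_equality)
  show "\<exists>f' g'. reduced_form u f' g' \<and>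
    max (Polynomial.degree f) (Polynomial.degree g) = max (Polynomial.degree f') (Polynomial.degree g')"
    using assms by blast
qed (use reduced_form_unique[OF assms] in fastforce)

lemma coprime_lin:
  fixes a b c d :: "'a::field"
  assumes "a * d - b * c \<noteq> 0"
  shows "coprime [:b, a:] [:d, c:]" 
proof (rule coprimeI)
  fix p assume p: "p dvd [:b, a:]" "p dvd [:d, c:]"
  have "p dvd Polynomial.smult c [:b,a:] - Polynomial.smult a [:d,c:]"
    using p by (intro dvd_diff dvd_smult)
  then have "p dvd [:c*b - a*d:]" by (simp add: mult.commute)
  moreover have "is_unit [:c*b - a*d:]" using assms
    by (subst is_unit_poly_iff) (auto simp: mult.commute dvd_field_iff)
  ultimately show "is_unit p" by (rule dvd_trans[of p _ 1])
qed

lemma reduced_lin_frac: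
  assumes "a * d - b * c \<noteq> 0"
  shows "reduced_form (lin_frac a b c d) [:b, a:] [:d, c:]"
  using assms coprime_lin[OF assms] by (auto simp: reduced_form_def lin_frac_def)

lemma lin_frac_alt: "lin_frac a b c d
   = (rf_const a * rf_X + rf_const b) / (rf_const c * rf_X + rf_const d)"
proof -
  have "[:x:] * [:0,1:] + [:y:] = [:y, x:]" for x y :: 'a by simp
  then show ?thesis
    unfolding lin_frac_def rf_const_def rf_X_def Fract_conv_to_fract
    by (simp only: flip: to_fract_add to_fract_mult)
qed

lemma lin_nz: "c \<noteq> 0 \<or> d \<noteq> 0 \<Longrightarrow> rf_const c * rf_X + rf_const d \<noteq> 0"
proof -
  assume a: "c \<noteq> 0 \<or> d \<noteq> 0"
  have "rf_const c * rf_X + rf_const d = to_fract [:d, c:]"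
    unfolding rf_const_def rf_X_def by (simp flip: to_fract_add to_fract_mult)
  then show ?thesis using a by auto
qed

lemma rf_comp_lin_frac:
  fixes a b c d :: "'a::field"
  assumes 1: "a * d - b * c \<noteq> 0" and 2: "a' * d' - b' * c' \<noteq> 0"
  shows "rf_comp (lin_frac a b c d) (lin_frac a' b' c' d') =
    lin_frac (a * a' + b * c') (a * b' + b * d') (c * a' + d * c') (c * b' + d * d')"
proof -
  have nz: "rf_const c' * rf_X + rf_const d' \<noteq> 0" using 2 by (intro lin_nz) auto
  have "rf_comp (lin_frac a b c d) (lin_frac a' b' c' d')
     = (rf_const b + lin_frac a' b' c' d' * rf_const a) / (rf_const d + lin_frac a' b' c' d' * rf_const c)"
    by (simp add: rf_comp_eq[OF reduced_lin_frac[OF 1]])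
  also have "rf_const b + lin_frac a' b' c' d' * rf_const a = 
     (rf_const b * (rf_const c' * rf_X + rf_const d') + rf_const a * (rf_const a' * rf_X + rf_const b')) / (rf_const c' * rf_X + rf_const d')"
    using nz by (simp add: lin_frac_alt field_simps)
  also have "rf_const d + lin_frac a' b' c' d' * rf_const c = 
     (rf_const d * (rf_const c' * rf_X + rf_const d') + rf_const c * (rf_const a' * rf_X + rf_const b')) / (rf_const c' * rf_X + rf_const d')"
    using nz by (simp add: lin_frac_alt field_simps)
  finally show ?thesis using nz
    by (simp add: lin_frac_alt[of "a * a' + b * c'"] rf_const_hom) (simp add: algebra_simps)
qed

lemma rf_X_lin_frac: "rf_X = lin_frac 1 0 0 1"
  by (simp add: lin_frac_alt rf_const_hom)

lemma group_PGL2: "group (PGL2 :: 'a::field ratfun monoid)"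
proof (rule groupI)
  fix x y :: "'a ratfun" assume "x \<in> carrier PGL2" "y \<in> carrier PGL2"
  then obtain a b c d a' b' c' d' where 
    *: "x = lin_frac a b c d" "y = lin_frac a' b' c' d'" "a * d - b * c \<noteq> 0" "a' * d' - b' * c' \<noteq> 0"
    by (auto simp: PGL2_def)
  have "(a * a' + b * c')*(c * b' + d * d') - (a * b' + b * d')* (c * a' + d * c') = (a * d - b * c) * (a' * d' - b' * c')"
    by (simp add: algebra_simps)
  then have "(a * a' + b * c')*(c * b' + d * d') - (a * b' + b * d')* (c * a' + d * c') \<noteq> 0" using * by simp
  then show "x \<otimes>\<^bsub>PGL2\<^esub> y \<in> carrier PGL2" 
    using * by (auto simp: PGL2_def rf_comp_lin_frac)
next
  show "\<one>\<^bsub>PGL2\<^esub> \<in> carrier (PGL2:: 'a ratfun monoid)"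
  proof -
    have "(1::'a) * 1 - 0 * 0 \<noteq> 0" by simp
    then show ?thesis unfolding PGL2_def rf_X_lin_frac monoid.simps partial_object.simps by blast
  qed
next
  fix x y z :: "'a ratfun" assume "x \<in> carrier PGL2" "y \<in> carrier PGL2" "z \<in> carrier PGL2"
  then obtain a b c d a' b' c' d' e f g h where 
    *: "x = lin_frac a b c d" "y = lin_frac a' b' c' d'" "z = lin_frac e f g h"
     "a * d - b * c \<noteq> 0" "a' * d' - b' * c' \<noteq> 0" "e * h - f * g \<noteq> 0"
    by (auto simp: PGL2_def)
  have "(a * a' + b * c')*(c * b' + d * d') - (a * b' + b * d')* (c * a' + d * c') = (a * d - b * c) * (a' * d' - b' * c')"
    by (simp add: algebra_simps)
  then have 1: "(a * a' + b * c')*(c * b' + d * d') - (a * b' + b * d')* (c * a' + d * c') \<noteq> 0" using * by simp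
  have "(a' * e + b' * g)*(c' * f + d' * h) - (a' * f + b' * h)* (c' * e + d' * g) = (a' * d' - b' * c') * (e * h - f * g)"
    by (simp add: algebra_simps)
  then have 2: "(a' * e + b' * g)*(c' * f + d' * h) - (a' * f + b' * h)* (c' * e + d' * g) \<noteq> 0" using * by simp
  show "x \<otimes>\<^bsub>PGL2\<^esub> y \<otimes>\<^bsub>PGL2\<^esub> z = x \<otimes>\<^bsub>PGL2\<^esub> (y \<otimes>\<^bsub>PGL2\<^esub> z)"
    unfolding PGL2_def monoid.simps *(1-3)
    by (simp only: rf_comp_lin_frac[OF *(4,5)] rf_comp_lin_frac[OF *(5,6)]
       rf_comp_lin_frac[OF 1 *(6)] rf_comp_lin_frac[OF *(4) 2]) (simp add: algebra_simps)
next
  fix x :: "'a ratfun" assume "x \<in> carrier PGL2"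
  then obtain a b c d where *: "x = lin_frac a b c d" "a * d - b * c \<noteq> 0"
    by (auto simp: PGL2_def)
  then show "\<one>\<^bsub>PGL2\<^esub> \<otimes>\<^bsub>PGL2\<^esub> x = x" 
    by (simp add: PGL2_def rf_X_lin_frac rf_comp_lin_frac)
  have 1: "d * a - (- b) * (- c) \<noteq> 0" using * by (simp add: algebra_simps)
  have "rf_comp (lin_frac d (-b) (-c) a) x = lin_frac (a*d-b*c) 0 0 (a*d-b*c)"
    unfolding *(1) rf_comp_lin_frac[OF 1 *(2)] by (simp add: algebra_simps)
  also have "\<dots> = rf_X" using *(2) lin_nz[of 0 "a*d-b*c"] 
    by (simp add: lin_frac_alt rf_const_hom)
  finally show "\<exists>y\<in>carrier PGL2. y \<otimes>\<^bsub>PGL2\<^esub> x = \<one>\<^bsub>PGL2\<^esub>"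
    using 1 unfolding PGL2_def monoid.simps partial_object.simps by blast
qed

definition fixed_field :: "'a::field ratfun set \<Rightarrow> 'a ratfun set" where
  "fixed_field H = {u. \<forall>\<psi>\<in>H. rf_comp u \<psi> = u}"

text \<open>The subfield \<open>F(h)\<close> of \<open>F(x)\<close> generated by the constants and \<open>h\<close>.\<close>
definition rf_adjoin :: "'a::field ratfun \<Rightarrow> 'a ratfun set" where
  "rf_adjoin h = generate_field ring_of_type_algebra (insert h (range rf_const))"


section \<open>Galois extensions\<close>

text \<open>
  Here \<open>K\<close> is a subset of the field \<open>L\<close> given by the ambient type, and polynomials over \<open>K\<close> are
  polynomials over \<open>L\<close> with coefficients in \<open>K\<close>.
\<close>
definition poly_over :: "'l::field set \<Rightarrow> 'l poly \<Rightarrow> bool" where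
  "poly_over K p \<longleftrightarrow> (\<forall>i. Polynomial.coeff p i \<in> K)"

definition irreducible_over :: "'l::field set \<Rightarrow> 'l poly \<Rightarrow> bool" where
  "irreducible_over K p \<longleftrightarrow>
     poly_over K p \<and> Polynomial.degree p > 0 \<and>
     (\<forall>q r. poly_over K q \<longrightarrow> poly_over K r \<longrightarrow> p = q * r \<longrightarrow>
        Polynomial.degree q = 0 \<or> Polynomial.degree r = 0)"

definition algebraic_extension :: "'l::field set \<Rightarrow> bool" where
  "algebraic_extension K \<longleftrightarrow> (\<forall>u. \<exists>p. p \<noteq> 0 \<and> poly_over K p \<and> poly p u = 0)"

definition normal_extension :: "'l::field set \<Rightarrow> bool" where
  "normal_extension K \<longleftrightarrow>
     (\<forall>p. irreducible_over K p \<and> (\<exists>u. poly p u = 0) \<longrightarrow>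
        (\<exists>us. p = Polynomial.smult (Polynomial.lead_coeff p) (\<Prod>u\<leftarrow>us. [:- u, 1:])))"

text \<open>
  Coprimality of \<open>p\<close> and its derivative does not depend on whether it is taken over \<open>K\<close> or \<open>L\<close>;
  it says that \<open>p\<close> has no multiple root in any extension field.
\<close>
definition separable_extension :: "'l::field set \<Rightarrow> bool" where
  "separable_extension K \<longleftrightarrow>
     (\<forall>p. irreducible_over K p \<and> (\<exists>u. poly p u = 0) \<longrightarrow> coprime p (pderiv p))"

definition galois_extension :: "'l::field set \<Rightarrow> bool" where
  "galois_extension K \<longleftrightarrow>
     subfield K ring_of_type_algebra \<and> algebraic_extension K \<and>
     normal_extension K \<and> separable_extension K"

end

theory Submission
  imports Defs
begin

text \<open>
  Write \<open>H\<close> for the cyclic group generated by \<open>\<phi>\<close>, so that \<open>h\<close> is the sum of \<open>H\<close> and is fixed by it. By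
  Cayley-Hamilton no nontrivial power of \<open>\<phi>\<close> is affine; hence the sum of the nontrivial powers is bounded
  at infinity, and \<open>h = f / g\<close> with coprime \<open>f\<close>, \<open>g\<close> and \<open>deg g < deg f \<le> card H\<close>. The nonzero polynomial
  \<open>f(T) - h g(T)\<close> over \<open>F(h)\<close> vanishes at \<open>x\<close>, hence at all elements of \<open>H\<close>, so \<open>deg f = card H\<close>.
  Invariants lie in \<open>F(h)\<close> by reduction modulo this polynomial. Finally, the minimal polynomial of
  \<open>u\<close> over the fixed field is the product of \<open>T - v\<close> over the distinct conjugates \<open>v\<close> of \<open>u\<close>, which gives
  normality and separability.
\<close>

section \<open>Fixed fields of finite sets of automorphisms\<close>

lemma a_inv_type_algebra: "\<ominus>\<^bsub>ring_of_type_algebra\<^esub> x = - (x :: 'l::field)"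
proof -
  interpret R: field "ring_of_type_algebra :: 'l ring" by (rule field_from_type_algebra)
  have "- x \<oplus>\<^bsub>ring_of_type_algebra\<^esub> x = \<zero>\<^bsub>ring_of_type_algebra\<^esub>"
    by (simp add: ring_of_type_algebra_def)
  then show ?thesis
    by (rule R.minus_equality) (simp_all add: ring_of_type_algebra_def)
qed

lemma m_inv_type_algebra:
  assumes "x \<noteq> 0" shows "inv\<^bsub>ring_of_type_algebra\<^esub> x = inverse (x :: 'l::field)"
proof -
  interpret R: field "ring_of_type_algebra :: 'l ring" by (rule field_from_type_algebra)
  show ?thesis
    by (rule R.comm_inv_char) (use assms in \<open>simp_all add: ring_of_type_algebra_def\<close>)
qed

lemma subfield_type_algebraI:
  fixes K :: "'l::field set"
  assumes "1 \<in> K" "\<And>x. x \<in> K \<Longrightarrow> - x \<in> K" "\<And>x. x \<in> K \<Longrightarrow> inverse x \<in> K"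
    "\<And>x y. x \<in> K \<Longrightarrow> y \<in> K \<Longrightarrow> x + y \<in> K" "\<And>x y. x \<in> K \<Longrightarrow> y \<in> K \<Longrightarrow> x * y \<in> K"
  shows "subfield K ring_of_type_algebra"
proof -
  interpret R: field "ring_of_type_algebra :: 'l ring" by (rule field_from_type_algebra)
  note ops = a_inv_type_algebra m_inv_type_algebra
  show ?thesis
  proof (rule R.subfieldI')
    show "subring K ring_of_type_algebra"
      by (rule R.subringI) (use assms in \<open>simp_all add: ops\<close>, simp_all add: ring_of_type_algebra_def)
    show "inv\<^bsub>ring_of_type_algebra\<^esub> k \<in> K" if "k \<in> K - {\<zero>\<^bsub>ring_of_type_algebra\<^esub>}" for k
      using that assms(3) ops(2)[of k] by (simp add: ring_of_type_algebra_def)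
  qed
qed

text \<open>The intended instances are the substitutions \<open>\<lambda>u. rf_comp u v\<close>.
  Since 1 is preserved, such a map is injective, and on a finite set that it maps into itself it is
  a permutation.\<close>

locale field_endo =
  fixes s :: "'l::field \<Rightarrow> 'l"
  assumes one: "s 1 = 1"
    and add: "s (x + y) = s x + s y"
    and mult: "s (x * y) = s x * s y"
begin

lemma zero: "s 0 = 0"
proof -
  have "s 0 + s 0 = s 0 + 0" using add[of 0 0] by simp
  then show ?thesis by (rule add_left_imp_eq)
qed

lemma uminus: "s (- x) = - s x"
  using add[of x "- x"] zero by (simp add: eq_neg_iff_add_eq_0 add.commute)

lemma diff: "s (x - y) = s x - s y"
  using add[of x "- y"] by (simp add: uminus)

lemma sum: "s (sum f A) = (\<Sum>x\<in>A. s (f x))"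
  by (induction A rule: infinite_finite_induct) (simp_all add: zero add)

lemma inverse: "s (inverse x) = inverse (s x)"
proof (cases "x = 0")
  case False
  then have "s (inverse x) * s x = 1" by (simp add: one flip: mult)
  then show ?thesis by (metis inverse_unique mult.commute)
qed (simp add: zero)

lemma divide: "s (x / y) = s x / s y"
  by (simp add: divide_inverse mult inverse)

lemma eq_0_iff: "s x = 0 \<longleftrightarrow> x = 0"
proof
  assume "s x = 0"
  then have "s (x * inverse x) = 0" by (simp add: mult)
  then show "x = 0" using one by (metis right_inverse zero_neq_one)
qed (simp add: zero)

lemma inj: "inj s"
  by (metis diff eq_0_iff injI right_minus_eq)

lemma map_poly_mult: "map_poly s (p * q) = map_poly s p * map_poly s q"
  by (rule poly_eqI) (simp add: coeff_map_poly zero coeff_mult sum mult)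

lemma map_poly_prod: "map_poly s (prod f A) = (\<Prod>x\<in>A. map_poly s (f x))"
  by (induction A rule: infinite_finite_induct) (simp_all add: one map_poly_mult)

text \<open>If \<open>s\<close> fixes the coefficients of \<open>p\<close>, it therefore sends roots
  of \<open>p\<close> to roots of \<open>p\<close>.\<close>

lemma poly_map_poly: "poly (map_poly s p) (s u) = s (poly p u)"
  by (induction p) (simp_all add: zero map_poly_pCons add mult)

lemma map_poly_eq_iff: "map_poly s p = p \<longleftrightarrow> (\<forall>i. s (Polynomial.coeff p i) = Polynomial.coeff p i)"
  by (simp add: poly_eq_iff coeff_map_poly zero)

end

section \<open>Products of distinct linear factors\<close>

lemma coprime_poly_mult_right:
  fixes f g h :: "'l::field poly"
  assumes "coprime f g" "coprime f h"
  shows "coprime f (g * h)"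
proof (rule coprimeI)
  fix c assume c: "c dvd f" "c dvd g * h"
  then have "coprime g c"
    using assms(1) by (meson coprime_commute coprime_divisors dvd_refl)
  then show "is_unit c"
    using c assms(2) by (meson coprime_common_divisor coprime_dvd_cancel)
qed

lemma coprime_add_mult_iff:
  fixes f g k :: "'l::field poly"
  shows "coprime f (f * k + g) \<longleftrightarrow> coprime f g"
  by (auto simp: coprime_def) (metis dvd_add_right_iff dvd_mult2)+

lemma coprime_linear:
  fixes a b :: "'l::field"
  assumes "a \<noteq> b"
  shows "coprime [:- a, 1:] [:- b, 1:]"
  by (rule coprime_lin) (use assms in simp)

lemma coprime_linear_prod:
  fixes A :: "'l::field set"
  assumes "a \<notin> A"
  shows "coprime [:- a, 1:] (\<Prod>v\<in>A. [:- v, 1:])"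
  using assms
  by (induction A rule: infinite_finite_induct)
    (simp_all add: coprime_linear coprime_poly_mult_right del: mult_pCons_left)

text \<open>By the Leibniz rule the derivative of \<open>l * m\<close> is congruent to
  \<open>m\<close> modulo \<open>l\<close> and to \<open>l * pderiv m\<close> modulo
  \<open>m\<close>. The first is coprime to \<open>l\<close> because the roots are distinct, the
  second to \<open>m\<close> by induction as well.\<close>

lemma coprime_pderiv_prod_linear:
  fixes A :: "'l::field set"
  shows "coprime (\<Prod>v\<in>A. [:- v, 1:]) (pderiv (\<Prod>v\<in>A. [:- v, 1:]))"
proof (induction A rule: infinite_finite_induct)
  case (insert a A)
  let ?l = "[:- a, 1:]" and ?m = "\<Prod>v\<in>A. [:- v, 1:]"
  have cop: "coprime ?l ?m" using insert.hyps by (simp add: coprime_linear_prod)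
  have deriv: "pderiv (?l * ?m) = ?l * pderiv ?m + ?m"
    by (simp only: pderiv_mult) (simp add: pderiv_pCons)
  have "coprime ?l (?l * pderiv ?m + ?m)"
    using cop by (simp only: coprime_add_mult_iff)
  moreover have "coprime ?m (?m * 1 + ?l * pderiv ?m)"
    using cop insert.IH
    by (simp only: coprime_add_mult_iff coprime_poly_mult_right coprime_commute[of ?m ?l])
  ultimately have "coprime (?l * ?m) (pderiv (?l * ?m))"
    unfolding deriv
    by (metis coprime_commute coprime_poly_mult_right add.commute mult_1_right)
  then show ?case using insert.hyps by simp
qed simp_all

text \<open>Split off one linear factor; the cofactor still vanishes at the other points because
  they differ from the first root.\<close>

lemma prod_linear_dvd:
  fixes p :: "'l::field poly"
  assumes "\<And>v. v \<in> A \<Longrightarrow> poly p v = 0"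
  shows "(\<Prod>v\<in>A. [:- v, 1:]) dvd p"
  using assms
proof (induction A arbitrary: p rule: infinite_finite_induct)
  case (insert a A)
  then obtain q where q: "p = [:- a, 1:] * q" by (metis poly_eq_0_iff_dvd dvdE insertI1)
  have "poly q v = 0" if "v \<in> A" for v
  proof -
    have "(v - a) * poly q v = 0" using insert.prems[of v] that q by (simp add: algebra_simps)
    moreover have "v \<noteq> a" using that insert.hyps by auto
    ultimately show ?thesis by simp
  qed
  then have "(\<Prod>v\<in>A. [:- v, 1:]) dvd q" by (rule insert.IH)
  then show ?case
    unfolding q prod.insert[OF insert.hyps] by (rule mult_dvd_mono[OF dvd_refl])
qed simp_all

text \<open>A form of Artin's theorem. Everything comes from one polynomial \<open>m u\<close> over
  the fixed field whose simple roots are the conjugates of \<open>u\<close>: each irreducible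
  polynomial with root \<open>u\<close> is a scalar multiple of it.\<close>

theorem galois_extension_fixed:
  fixes S :: "('l::field \<Rightarrow> 'l) set"
  assumes fin: "finite S" and id: "id \<in> S" and endo: "\<And>s. s \<in> S \<Longrightarrow> field_endo s"
    and comp: "\<And>s t. s \<in> S \<Longrightarrow> t \<in> S \<Longrightarrow> s \<circ> t \<in> S"
  shows "galois_extension {u. \<forall>s\<in>S. s u = u}" (is "galois_extension ?K")
proof -
  \<comment> \<open>The product runs over an image set, so a value taken by several \<open>s\<close>
    contributes one factor only; this makes \<open>m u\<close> squarefree.\<close>
  define m where "m u = (\<Prod>v\<in>(\<lambda>s. s u) ` S. [:- v, 1:])" for u
  have over_iff: "poly_over ?K p \<longleftrightarrow> (\<forall>s\<in>S. map_poly s p = p)" for p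
    using endo by (auto simp: poly_over_def field_endo.map_poly_eq_iff)
  have m_over: "poly_over ?K (m u)" for u
    unfolding over_iff
  proof
    fix s assume s: "s \<in> S"
    then interpret field_endo s by (rule endo)
    \<comment> \<open>The injective \<open>s\<close> maps the finite orbit of \<open>u\<close> into
      itself, so it permutes the factors of \<open>m u\<close>.\<close>
    have "s ` (\<lambda>s. s u) ` S \<subseteq> (\<lambda>s. s u) ` S"
      using comp[OF s] by (force simp: o_def)
    then have perm: "s ` (\<lambda>s. s u) ` S = (\<lambda>s. s u) ` S"
      using fin inj by (intro endo_inj_surj) (auto intro: inj_on_subset)
    have "map_poly s (m u) = (\<Prod>v\<in>(\<lambda>s. s u) ` S. [:- s v, 1:])"
      by (simp add: m_def map_poly_prod map_poly_pCons zero uminus one)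
    also have "\<dots> = (\<Prod>v\<in>s ` (\<lambda>s. s u) ` S. [:- v, 1:])"
      using inj by (subst prod.reindex) (auto intro: inj_on_subset)
    finally show "map_poly s (m u) = m u"
      by (simp only: perm m_def)
  qed
  have m_root: "poly (m u) u = 0" for u
  proof -
    have "u \<in> (\<lambda>s. s u) ` S" using id by (rule rev_image_eqI) simp
    then show ?thesis
      using fin by (simp add: m_def poly_prod prod_zero_iff)
  qed
  have m_nz: "m u \<noteq> 0" for u
    using fin by (auto simp: m_def)
  have m_deg: "Polynomial.degree (m u) > 0" for u
  proof (rule ccontr)
    assume "\<not> Polynomial.degree (m u) > 0"
    then obtain c where "m u = [:c:]" by (auto elim: degree_eq_zeroE)
    then show False using m_root[of u] m_nz[of u] by simp
  qed
  have key: "\<exists>c. c \<noteq> 0 \<and> p = Polynomial.smult c (m u)"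
    if p: "irreducible_over ?K p" "poly p u = 0" for p u
  proof -
    have p_over: "poly_over ?K p" and p_deg: "Polynomial.degree p > 0"
      using p(1) by (auto simp: irreducible_over_def)
    have "poly p (s u) = 0" if "s \<in> S" for s
      using field_endo.poly_map_poly[OF endo[OF that], of p u] p(2) p_over that
        field_endo.zero[OF endo[OF that]]
      by (simp add: over_iff)
    then have "m u dvd p"
      unfolding m_def
      by (intro prod_linear_dvd) auto
    then obtain q where q: "p = m u * q" ..
    \<comment> \<open>Applying \<open>s\<close> to \<open>p = m u * q\<close> and cancelling
      \<open>m u\<close> shows that the coefficients of \<open>q\<close> are fixed too.\<close>
    have "poly_over ?K q"
      unfolding over_iff
    proof
      fix s assume s: "s \<in> S"
      then interpret field_endo s by (rule endo)
      have "m u * map_poly s q = map_poly s (m u) * map_poly s q"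
        using m_over[of u] s by (simp add: over_iff)
      also have "\<dots> = m u * q"
        using p_over s q by (simp add: over_iff flip: map_poly_mult)
      finally show "map_poly s q = q" using m_nz by simp
    qed
    then have "Polynomial.degree q = 0"
      using p(1) q m_over[of u] m_deg[of u] by (auto simp: irreducible_over_def)
    then obtain c where "q = [:c:]" by (rule degree_eq_zeroE)
    then show ?thesis using q p_deg by (intro exI[of _ c]) auto
  qed
  show ?thesis
    unfolding galois_extension_def
  proof (intro conjI)
    show "subfield ?K ring_of_type_algebra"
      by (rule subfield_type_algebraI)
        (use endo in \<open>auto simp: field_endo.one field_endo.uminus field_endo.inverse field_endo.add field_endo.mult\<close>)
    show "algebraic_extension ?K"
      unfolding algebraic_extension_def using m_nz m_over m_root by blast
    show "normal_extension ?K"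
      unfolding normal_extension_def
    proof (intro allI impI)
      fix p assume "irreducible_over ?K p \<and> (\<exists>u. poly p u = 0)"
      then obtain u c where c: "p = Polynomial.smult c (m u)" using key by blast
      obtain us where us: "set us = (\<lambda>s. s u) ` S" "distinct us"
        using finite_distinct_list[of "(\<lambda>s. s u) ` S"] fin by auto
      have "m u = (\<Prod>v\<leftarrow>us. [:- v, 1:])"
        unfolding m_def us(1)[symmetric] using us(2) by (rule prod.distinct_set_conv_list)
      moreover have "Polynomial.lead_coeff (m u) = 1"
        by (simp add: m_def lead_coeff_prod)
      ultimately show "\<exists>us. p = Polynomial.smult (Polynomial.lead_coeff p) (\<Prod>u\<leftarrow>us. [:- u, 1:])"
        using c by (intro exI[of _ us]) simp
    qed
    show "separable_extension ?K"
      unfolding separable_extension_def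
    proof (intro allI impI)
      fix p assume "irreducible_over ?K p \<and> (\<exists>u. poly p u = 0)"
      then obtain u c where c: "c \<noteq> 0" "p = Polynomial.smult c (m u)" using key by blast
      have "coprime (m u) (pderiv (m u))"
        unfolding m_def by (rule coprime_pderiv_prod_linear)
      then show "coprime p (pderiv p)"
        using c by (simp add: pderiv_smult coprime_def dvd_smult_iff)
    qed
  qed
qed

section \<open>Composition of rational functions\<close>

lemma coprime_reduction:
  fixes f g :: "'a::field poly"
  assumes "g \<noteq> 0"
  shows "\<exists>f' g' k. f = f' * k \<and> g = g' * k \<and> coprime f' g'"
  using assms
proof (induction "Polynomial.degree g" arbitrary: f g rule: less_induct)
  case less
  show ?case
  proof (cases "coprime f g")
    case True
    then show ?thesis by (intro exI[of _ f] exI[of _ g] exI[of _ 1]) simp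
  next
    case False
    then obtain k where k: "k dvd f" "k dvd g" "\<not> is_unit k" by (auto simp: coprime_def)
    then obtain f1 g1 where fg: "f = f1 * k" "g = g1 * k" by (metis dvdE mult.commute)
    have nz: "g1 \<noteq> 0" "k \<noteq> 0" using less.prems fg by auto
    \<comment> \<open>A nonzero nonunit over a field has positive degree, so dividing out
      \<open>k\<close> lowers the degree of the denominator.\<close>
    then have "Polynomial.degree k \<noteq> 0" using k(3) by (simp add: is_unit_iff_degree)
    then have "Polynomial.degree g1 < Polynomial.degree g"
      using nz fg by (simp add: degree_mult_eq)
    from less.hyps[OF this nz(1), of f1] obtain f' g' k'
      where *: "f1 = f' * k'" "g1 = g' * k'" "coprime f' g'" by blast
    then show ?thesis using fg
      by (intro exI[of _ f'] exI[of _ g'] exI[of _ "k' * k"]) (simp add: mult.assoc)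
  qed
qed

lemma reduced_form_of_Fract:
  assumes "g \<noteq> (0 :: 'a::field poly)"
  obtains f' g' k where "reduced_form (Fract f g) f' g'" "f = f' * k" "g = g' * k"
proof -
  obtain f' g' k where *: "f = f' * k" "g = g' * k" "coprime f' g'"
    using coprime_reduction[OF assms] by blast
  with assms have "reduced_form (Fract f g) f' g'"
    by (auto simp: reduced_form_def eq_fract)
  with * that show ?thesis by blast
qed

lemma poly_at_1 [simp]: "poly_at 1 v = 1"
  by (simp add: one_pCons rf_const_hom)

lemma to_fract_conv_poly_at: "to_fract f = poly_at f rf_X"
proof (induction f)
  case (pCons a f)
  have "to_fract (pCons a f) = to_fract ([:a:] + [:0, 1:] * f)" by simp
  then show ?case using pCons
    by (simp only: to_fract_add to_fract_mult poly_at_pCons rf_const_def rf_X_def)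
qed simp

lemma Fract_conv_poly_at: "Fract f g = poly_at f rf_X / poly_at g rf_X"
  by (simp add: Fract_conv_to_fract to_fract_conv_poly_at)

lemma poly_at_rf_X_eq_0_iff: "poly_at f rf_X = 0 \<longleftrightarrow> f = 0"
  by (simp flip: to_fract_conv_poly_at)

text \<open>Transcendence over the constants: no nonzero denominator vanishes when \<open>v\<close>
  is substituted, so the convention for division by 0 does not interfere with composition.\<close>

definition rf_transcendental :: "'a::field ratfun \<Rightarrow> bool" where
  "rf_transcendental v \<longleftrightarrow> (\<forall>f. poly_at f v = 0 \<longrightarrow> f = 0)"

text \<open>Composition is defined through a reduced fraction; the common factor of an arbitrary one
  cancels because its value at \<open>v\<close> is nonzero.\<close>

lemma rf_comp_Fract:
  assumes v: "rf_transcendental v" and g: "g \<noteq> 0"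
  shows "rf_comp (Fract f g) v = poly_at f v / poly_at g v"
proof -
  obtain f' g' k where *: "reduced_form (Fract f g) f' g'" "f = f' * k" "g = g' * k"
    using reduced_form_of_Fract[OF g] by blast
  have "poly_at k v \<noteq> 0" using v g * by (auto simp: rf_transcendental_def)
  then show ?thesis using rf_comp_eq[OF *(1), of v] * by simp
qed

lemma rf_comp_poly_at:
  assumes "rf_transcendental v"
  shows "rf_comp (poly_at f rf_X) v = poly_at f v"
  using rf_comp_Fract[OF assms, of 1 f] by (simp add: Fract_conv_poly_at)

lemma rf_comp_const:
  assumes "rf_transcendental v"
  shows "rf_comp (rf_const c) v = rf_const c"
  using rf_comp_poly_at[OF assms, of "[:c:]"] by simp

lemma rf_comp_X_right: "rf_comp u rf_X = (u :: 'a::field ratfun)"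
proof (cases u)
  case (Fract f g)
  have "rf_transcendental (rf_X :: 'a ratfun)"
    by (simp add: rf_transcendental_def poly_at_rf_X_eq_0_iff)
  then have "rf_comp u rf_X = poly_at f rf_X / poly_at g rf_X"
    unfolding Fract(1) using Fract(2) by (rule rf_comp_Fract)
  then show ?thesis using Fract(1) Fract_conv_poly_at by metis
qed

lemma field_endo_rf_comp:
  fixes v :: "'a::field ratfun"
  assumes v: "rf_transcendental v"
  shows "field_endo (\<lambda>u. rf_comp u v)"
proof
  show "rf_comp 1 v = 1"
    using rf_comp_const[OF v, of 1] by (simp add: rf_const_hom)
next
  fix x y :: "'a ratfun"
  obtain f g f' g' where *: "x = Fract f g" "g \<noteq> 0" "y = Fract f' g'" "g' \<noteq> 0"
    by (metis Fract_cases)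
  moreover from this have "poly_at g v \<noteq> 0" "poly_at g' v \<noteq> 0"
    using v by (auto simp: rf_transcendental_def)
  ultimately show "rf_comp (x + y) v = rf_comp x v + rf_comp y v"
    and "rf_comp (x * y) v = rf_comp x v * rf_comp y v"
    by (simp_all add: rf_comp_Fract[OF v] field_simps)
qed

text \<open>Substituting \<open>w\<close> is a field endomorphism that fixes the constants, so it
  commutes with evaluating a polynomial at \<open>v\<close>.\<close>

lemma rf_comp_assoc:
  assumes v: "rf_transcendental v" and w: "rf_transcendental w"
    and vw: "rf_transcendental (rf_comp v w)"
  shows "rf_comp (rf_comp u v) w = rf_comp u (rf_comp v w)"
proof (cases u)
  case (Fract f g)
  interpret field_endo "\<lambda>u. rf_comp u w" by (rule field_endo_rf_comp[OF w])
  have "rf_comp (poly_at f v) w = poly_at f (rf_comp v w)" for f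
    by (induction f) (simp_all add: zero add mult rf_comp_const[OF w])
  then show ?thesis using Fract
    by (simp add: rf_comp_Fract[OF v] rf_comp_Fract[OF vw] divide)
qed

section \<open>Transcendence of nonconstant fractions\<close>

lemma to_fract_power: "to_fract (q ^ n) = to_fract q ^ n"
  by (induction n) simp_all

text \<open>After clearing denominators every term of \<open>f\<close> below the top one keeps a
  factor \<open>q\<close>; \<open>s\<close> collects these terms.\<close>

lemma poly_at_Fract_homogenize:
  assumes "q \<noteq> (0 :: 'a::field poly)" "f \<noteq> 0"
  shows "\<exists>s. to_fract q ^ Polynomial.degree f * poly_at f (Fract p q) =
    to_fract (Polynomial.smult (Polynomial.lead_coeff f) (p ^ Polynomial.degree f) + q * s)"
  using assms(2)
proof (induction f)
  case (pCons a f)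
  let ?Q = "to_fract q" and ?v = "Fract p q"
  have Qv: "?Q * ?v = to_fract p" using assms(1) by (simp add: Fract_conv_to_fract)
  show ?case
  proof (cases "f = 0")
    case True
    then show ?thesis by (intro exI[of _ 0]) (simp add: rf_const_def)
  next
    case False
    with pCons obtain s where s: "?Q ^ Polynomial.degree f * poly_at f ?v =
      to_fract (Polynomial.smult (Polynomial.lead_coeff f) (p ^ Polynomial.degree f) + q * s)"
      (is "_ = to_fract ?R") by blast
    have "?Q ^ Polynomial.degree (pCons a f) * poly_at (pCons a f) ?v =
        ?Q * ?Q ^ Polynomial.degree f * rf_const a + (?Q * ?v) * (?Q ^ Polynomial.degree f * poly_at f ?v)"
      using False by (simp add: algebra_simps)
    also have "\<dots> = to_fract (q * q ^ Polynomial.degree f * [:a:] + p * ?R)"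
      unfolding Qv s rf_const_def by (simp only: to_fract_add to_fract_mult to_fract_power)
    also have "q * q ^ Polynomial.degree f * [:a:] + p * ?R =
        Polynomial.smult (Polynomial.lead_coeff (pCons a f)) (p ^ Polynomial.degree (pCons a f))
        + q * (q ^ Polynomial.degree f * [:a:] + p * s)"
      using False by (simp add: algebra_simps)
    finally show ?thesis by blast
  qed
qed simp

text \<open>The denominator of a root of \<open>f\<close> divides the leading term of the homogenisation of \<open>f\<close>.\<close>
lemma rf_transcendental_Fract:
  fixes p q :: "'a::field poly"
  assumes cop: "coprime p q" and deg: "Polynomial.degree q > 0"
  shows "rf_transcendental (Fract p q)"
  unfolding rf_transcendental_def
proof (intro allI impI, rule ccontr)
  fix f assume f: "poly_at f (Fract p q) = 0" "f \<noteq> 0"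
  have "q \<noteq> 0" using deg by auto
  from poly_at_Fract_homogenize[OF this f(2), of p] f(1)
  obtain s where "Polynomial.smult (Polynomial.lead_coeff f) (p ^ Polynomial.degree f) + q * s = 0"
    by (auto simp del: to_fract_add)
  then have "Polynomial.smult (Polynomial.lead_coeff f) (p ^ Polynomial.degree f) = q * (- s)"
    by (simp add: eq_neg_iff_add_eq_0)
  then have "q dvd Polynomial.smult (Polynomial.lead_coeff f) (p ^ Polynomial.degree f)"
    by (metis dvd_triv_left)
  then have dvd: "q dvd p ^ Polynomial.degree f" using f(2) by (simp add: dvd_smult_iff)
  have "coprime q (p ^ m)" for m
    using cop by (induction m) (simp_all add: coprime_poly_mult_right coprime_commute[of q p])
  with dvd have "is_unit q" by (metis coprime_common_divisor dvd_refl)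
  with deg \<open>q \<noteq> 0\<close> show False by (simp add: is_unit_iff_degree)
qed

lemma poly_at_to_fract: "poly_at f (to_fract p) = to_fract (pcompose f p)"
proof (induction f)
  case (pCons a f)
  then show ?case by (simp only: poly_at_pCons pcompose_pCons to_fract_add to_fract_mult rf_const_def)
qed simp

lemma rf_transcendental_to_fract:
  assumes "Polynomial.degree p > 0"
  shows "rf_transcendental (to_fract p)"
  unfolding rf_transcendental_def poly_at_to_fract to_fract_eq_0_iff
  using pcompose_eq_0[OF _ assms] by blast

text \<open>For \<open>c\<close> nonzero the fraction is reduced with a denominator of degree 1; for
  \<open>c = 0\<close> it is a polynomial of degree 1.\<close>

lemma rf_transcendental_lin_frac:
  assumes det: "a * d - b * c \<noteq> (0 :: 'a::field)"
  shows "rf_transcendental (lin_frac a b c d)"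
proof (cases "c = 0")
  case False
  then show ?thesis
    unfolding lin_frac_def using coprime_lin[OF det] by (intro rf_transcendental_Fract) simp_all
next
  case True
  then have ad: "a \<noteq> 0" "d \<noteq> 0" using det by auto
  then have "lin_frac a b c d = to_fract [:b / d, a / d:]"
    using True by (simp add: lin_frac_def to_fract_def eq_fract)
  then show ?thesis using ad by (simp add: rf_transcendental_to_fract)
qed

section \<open>The right action by substitution\<close>

lemma mult_PGL2: "v \<otimes>\<^bsub>PGL2\<^esub> w = rf_comp v w"
  by (simp add: PGL2_def)

lemma one_PGL2: "\<one>\<^bsub>PGL2\<^esub> = rf_X"
  by (simp add: PGL2_def)

lemma rf_transcendental_PGL2: "v \<in> carrier PGL2 \<Longrightarrow> rf_transcendental v"
  by (auto simp: PGL2_def rf_transcendental_lin_frac)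

lemma rf_comp_assoc_PGL2:
  fixes u v w :: "'a::field ratfun"
  assumes vw: "v \<in> carrier PGL2" "w \<in> carrier PGL2"
  shows "rf_comp (rf_comp u v) w = rf_comp u (v \<otimes>\<^bsub>PGL2\<^esub> w)"
proof -
  interpret group "PGL2 :: 'a ratfun monoid" by (rule group_PGL2)
  have "rf_comp v w \<in> carrier PGL2" using m_closed[OF vw] by (simp add: mult_PGL2)
  then show ?thesis
    using vw by (simp only: mult_PGL2 rf_comp_assoc rf_transcendental_PGL2)
qed

corollary galois_extension_fixed_field:
  assumes H: "subgroup H PGL2" and fin: "finite H"
  shows "galois_extension (fixed_field H)"
proof -
  interpret subgroup H PGL2 by (rule H)
  define S where "S = (\<lambda>v u. rf_comp u v) ` H"
  have "fixed_field H = {u. \<forall>s\<in>S. s u = u}"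
    by (auto simp: fixed_field_def S_def)
  also have "galois_extension \<dots>"
  proof (rule galois_extension_fixed)
    show "finite S" using fin by (simp add: S_def)
    have "rf_X \<in> H" using one_closed by (simp add: one_PGL2)
    then show "id \<in> S" unfolding S_def by (rule rev_image_eqI) (simp add: rf_comp_X_right fun_eq_iff)
    show "field_endo s" if "s \<in> S" for s
    proof -
      from that obtain v where "v \<in> H" "s = (\<lambda>u. rf_comp u v)" by (auto simp: S_def)
      then show ?thesis
        using subset by (auto intro: field_endo_rf_comp rf_transcendental_PGL2)
    qed
    show "s \<circ> t \<in> S" if "s \<in> S" "t \<in> S" for s t
    proof -
      from that obtain v w where vw: "v \<in> H" "w \<in> H" "s = (\<lambda>u. rf_comp u v)" "t = (\<lambda>u. rf_comp u w)"
        by (auto simp: S_def)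
      \<comment> \<open>The order is reversed: \<open>t\<close> substitutes \<open>w\<close> first,
        and \<open>s\<close> then substitutes \<open>v\<close> into the result.\<close>
      then have "s \<circ> t = (\<lambda>u. rf_comp u (w \<otimes>\<^bsub>PGL2\<^esub> v))"
        by (simp add: fun_eq_iff rf_comp_assoc_PGL2)
      then show ?thesis using vw by (auto simp: S_def)
    qed
  qed
  finally show ?thesis .
qed

section \<open>Fixed fields as simple extensions of the constants\<close>

lemma rf_adjoin_closed:
  shows rf_const_in_adjoin: "rf_const c \<in> rf_adjoin h"
    and self_in_adjoin: "h \<in> rf_adjoin h"
    and rf_adjoin_add: "x \<in> rf_adjoin h \<Longrightarrow> y \<in> rf_adjoin h \<Longrightarrow> x + y \<in> rf_adjoin h"
    and rf_adjoin_mult: "x \<in> rf_adjoin h \<Longrightarrow> y \<in> rf_adjoin h \<Longrightarrow> x * y \<in> rf_adjoin h"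
    and rf_adjoin_uminus: "x \<in> rf_adjoin h \<Longrightarrow> - x \<in> rf_adjoin h"
proof -
  let ?R = "ring_of_type_algebra :: 'a ratfun ring" and ?G = "insert h (range rf_const)"
  show "rf_const c \<in> rf_adjoin h" "h \<in> rf_adjoin h"
    by (auto simp: rf_adjoin_def intro: generate_field.incl)
  show "x \<in> rf_adjoin h \<Longrightarrow> y \<in> rf_adjoin h \<Longrightarrow> x + y \<in> rf_adjoin h"
    using generate_field.eng_add[of x ?R ?G y]
    by (simp add: rf_adjoin_def ring_of_type_algebra_def)
  show "x \<in> rf_adjoin h \<Longrightarrow> y \<in> rf_adjoin h \<Longrightarrow> x * y \<in> rf_adjoin h"
    using generate_field.eng_mult[of x ?R ?G y]
    by (simp add: rf_adjoin_def ring_of_type_algebra_def)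
  show "x \<in> rf_adjoin h \<Longrightarrow> - x \<in> rf_adjoin h"
    using generate_field.a_inv[of x ?R ?G] by (simp add: rf_adjoin_def a_inv_type_algebra)
qed

lemma rf_adjoin_diff: "x \<in> rf_adjoin h \<Longrightarrow> y \<in> rf_adjoin h \<Longrightarrow> x - y \<in> rf_adjoin h"
  using rf_adjoin_add[of x h "- y"] by (simp add: rf_adjoin_uminus)

lemma rf_adjoin_divide:
  assumes "x \<in> rf_adjoin h" "y \<in> rf_adjoin h"
  shows "x / y \<in> rf_adjoin h"
proof (cases "y = 0")
  case True
  then show ?thesis using rf_const_in_adjoin[of 0 h] by (simp add: rf_const_hom)
next
  case False
  then have "inverse y \<in> rf_adjoin h"
    using generate_field.m_inv[of y ring_of_type_algebra "insert h (range rf_const)"] assms(2)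
      m_inv_type_algebra[of y]
    by (simp add: rf_adjoin_def) (simp add: ring_of_type_algebra_def)
  then show ?thesis using assms(1) by (simp add: divide_inverse rf_adjoin_mult)
qed

lemma rf_adjoin_subset_fixed_field:
  assumes H: "H \<subseteq> carrier PGL2" and h: "h \<in> fixed_field H"
  shows "rf_adjoin h \<subseteq> fixed_field H"
proof
  fix u assume "u \<in> rf_adjoin h"
  then have "rf_comp u \<psi> = u" if \<psi>: "\<psi> \<in> H" for \<psi>
  proof -
    have tr: "rf_transcendental \<psi>" using H \<psi> by (auto intro: rf_transcendental_PGL2)
    interpret E: field_endo "\<lambda>u. rf_comp u \<psi>" by (rule field_endo_rf_comp[OF tr])
    from \<open>u \<in> rf_adjoin h\<close> show ?thesis
      unfolding rf_adjoin_def
    proof induction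
      case one
      then show ?case using E.one by (simp add: ring_of_type_algebra_def)
    next
      case (incl v)
      then show ?case using h \<psi> rf_comp_const[OF tr] by (auto simp: fixed_field_def)
    next
      case (a_inv v)
      then show ?case by (simp add: a_inv_type_algebra E.uminus)
    next
      case (m_inv v)
      then have "v \<noteq> 0" by (simp add: ring_of_type_algebra_def)
      then show ?case using m_inv by (simp add: m_inv_type_algebra E.inverse)
    next
      case (eng_add v w)
      then show ?case using E.add[of v w] by (simp add: ring_of_type_algebra_def)
    next
      case (eng_mult v w)
      then show ?case using E.mult[of v w] by (simp add: ring_of_type_algebra_def)
    qed
  qed
  then show "u \<in> fixed_field H" by (simp add: fixed_field_def)
qed

text \<open>Since \<open>P\<close> is monic, dividing by it only uses multiples of \<open>P\<close>
  with coefficients in \<open>K\<close>, so the remainder stays over \<open>K\<close>.\<close>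

lemma monic_reduction:
  fixes K :: "'l::field set"
  assumes K: "0 \<in> K" "\<And>x y. x \<in> K \<Longrightarrow> y \<in> K \<Longrightarrow> x - y \<in> K" "\<And>x y. x \<in> K \<Longrightarrow> y \<in> K \<Longrightarrow> x * y \<in> K"
    and P: "poly_over K P" "Polynomial.lead_coeff P = 1" "Polynomial.degree P > 0"
    and p: "poly_over K p"
  shows "\<exists>r. poly_over K r \<and> Polynomial.degree r < Polynomial.degree P \<and> P dvd p - r"
  using p
proof (induction p)
  case 0
  then show ?case using P(3) by (intro exI[of _ 0]) simp
next
  case (pCons a p)
  have "a \<in> K" using pCons.prems by (auto simp: poly_over_def dest: spec[of _ 0])
  have "poly_over K p"
    unfolding poly_over_def
  proof
    fix i show "Polynomial.coeff p i \<in> K"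
      using pCons.prems by (auto simp: poly_over_def dest: spec[of _ "Suc i"])
  qed
  with pCons.IH obtain r where r: "poly_over K r" "Polynomial.degree r < Polynomial.degree P" "P dvd p - r"
    by blast
  define n where "n = Polynomial.degree P"
  \<comment> \<open>Multiplication by \<open>T\<close> moves the coefficient of degree
    \<open>n - 1\<close> to degree \<open>n\<close>, where subtracting \<open>c\<close> times the
    monic \<open>P\<close> cancels it.\<close>
  define c where "c = Polynomial.coeff r (n - 1)"
  define r' where "r' = pCons a r - Polynomial.smult c P"
  have "c \<in> K" using r(1) by (simp add: c_def poly_over_def)
  have "poly_over K r'"
    using K P(1) r(1) \<open>a \<in> K\<close> \<open>c \<in> K\<close>
    by (auto simp: poly_over_def r'_def coeff_pCons split: nat.split)
  moreover have "Polynomial.degree r' < n"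
  proof (rule degree_lessI)
    show "r' \<noteq> 0 \<or> n > 0" using P(3) by (simp add: n_def)
    show "\<forall>k\<ge>n. Polynomial.coeff r' k = 0"
    proof (intro allI impI)
      fix k assume "k \<ge> n"
      then consider "k = n" | "k > n" by linarith
      then show "Polynomial.coeff r' k = 0"
      proof cases
        case 1
        then show ?thesis
          using P(2,3) by (cases n) (simp_all add: r'_def c_def flip: n_def)
      next
        case 2
        then show ?thesis
          using r(2) by (cases k) (simp_all add: r'_def coeff_eq_0 n_def)
      qed
    qed
  qed
  moreover have "P dvd pCons a p - r'"
  proof -
    have "pCons a p - r' = [:0, 1:] * (p - r) + Polynomial.smult c P"
      by (simp add: r'_def)
    then show ?thesis using r(3) by (simp only: dvd_add dvd_mult dvd_smult dvd_refl)
  qed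
  ultimately show ?case unfolding n_def by blast
qed

text \<open>The polynomial \<open>f(T) - h g(T)\<close> over \<open>F(h)\<close>, where \<open>h = f / g\<close>. It has the root \<open>x\<close>, hence
  also every \<open>\<psi>\<close> that fixes \<open>h\<close>.\<close>
definition rf_relation :: "'a::field poly \<Rightarrow> 'a poly \<Rightarrow> 'a ratfun poly" where
  "rf_relation f g = map_poly rf_const f - Polynomial.smult (Fract f g) (map_poly rf_const g)"

lemma coeff_map_rf_const: "Polynomial.coeff (map_poly rf_const f) i = rf_const (Polynomial.coeff f i)"
  by (simp add: coeff_map_poly rf_const_hom)

lemma poly_over_map_rf_const: "poly_over (rf_adjoin h) (map_poly rf_const f)"
  by (simp add: poly_over_def coeff_map_rf_const rf_const_in_adjoin)

text \<open>As \<open>g\<close> has the smaller degree, \<open>Fract f g\<close> does not enter the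
  top coefficient, which is a nonzero constant.\<close>

lemma degree_rf_relation:
  assumes "Polynomial.degree g < Polynomial.degree f"
  shows "Polynomial.degree (rf_relation f g) = Polynomial.degree f"
    and "Polynomial.lead_coeff (rf_relation f g) = rf_const (Polynomial.lead_coeff f)"
proof -
  let ?P = "rf_relation f g"
  have top: "Polynomial.coeff ?P (Polynomial.degree f) = rf_const (Polynomial.lead_coeff f)"
    using assms by (simp add: rf_relation_def coeff_map_rf_const coeff_eq_0 rf_const_hom)
  have "Polynomial.degree ?P \<le> Polynomial.degree f"
    using assms by (intro degree_le) (auto simp: rf_relation_def coeff_map_rf_const coeff_eq_0 rf_const_hom)
  moreover have "Polynomial.degree f \<le> Polynomial.degree ?P"
    using assms top by (intro le_degree) (auto simp: rf_const_hom)
  ultimately show "Polynomial.degree ?P = Polynomial.degree f" by (rule antisym)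
  then show "Polynomial.lead_coeff ?P = rf_const (Polynomial.lead_coeff f)" using top by simp
qed

lemma poly_over_rf_relation: "poly_over (rf_adjoin (Fract f g)) (rf_relation f g)"
  by (simp add: poly_over_def rf_relation_def coeff_map_rf_const rf_adjoin_closed rf_adjoin_diff)

text \<open>Invariance under \<open>\<psi>\<close> reads
  \<open>f(\<psi>) / g(\<psi>) = f / g\<close>; transcendence of \<open>\<psi>\<close> allows
  clearing the denominator \<open>g(\<psi>)\<close>.\<close>

lemma fixed_field_Fract:
  assumes "H \<subseteq> carrier PGL2" "Fract f g \<in> fixed_field H" "g \<noteq> 0" "\<psi> \<in> H"
  shows "poly_at f \<psi> = Fract f g * poly_at g \<psi>"
proof -
  have tr: "rf_transcendental \<psi>" using assms by (auto intro: rf_transcendental_PGL2)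
  then have "poly_at g \<psi> \<noteq> 0" using assms(3) by (auto simp: rf_transcendental_def)
  moreover have "Fract f g = poly_at f \<psi> / poly_at g \<psi>"
    using assms rf_comp_Fract[OF tr, of g f] by (simp add: fixed_field_def)
  ultimately show ?thesis by simp
qed

lemma poly_rf_relation:
  assumes "H \<subseteq> carrier PGL2" "Fract f g \<in> fixed_field H" "g \<noteq> 0" "\<psi> \<in> H"
  shows "poly (rf_relation f g) \<psi> = 0"
  using fixed_field_Fract[OF assms] by (simp add: rf_relation_def poly_at_def)

text \<open>The elements of \<open>H\<close> are distinct roots of \<open>rf_relation f g\<close> in
  the field of rational functions.\<close>

lemma card_le_degree_fixed:
  assumes H: "H \<subseteq> carrier PGL2" and fixed: "Fract f g \<in> fixed_field H" and "g \<noteq> 0"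
    and deg: "Polynomial.degree g < Polynomial.degree f"
  shows "card H \<le> Polynomial.degree f"
proof -
  have nz: "rf_relation f g \<noteq> 0" using degree_rf_relation(1)[OF deg] deg by auto
  have "card H \<le> card {v. poly (rf_relation f g) v = 0}"
    using poly_rf_relation[OF H fixed \<open>g \<noteq> 0\<close>] nz by (intro card_mono poly_roots_finite) auto
  also have "\<dots> \<le> Polynomial.degree (rf_relation f g)" by (rule card_poly_roots_bound[OF nz])
  finally show ?thesis by (simp add: degree_rf_relation(1)[OF deg])
qed

text \<open>Reducing numerator and denominator of an invariant \<open>u = A / B\<close> modulo the relation satisfied by
  \<open>x\<close> makes \<open>A(T) - u B(T)\<close> a polynomial of degree less than \<open>card H\<close> that vanishes on \<open>H\<close>; so it is
  zero, and \<open>u\<close> is a ratio of coefficients.\<close>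
theorem fixed_field_eq_rf_adjoin:
  fixes f g :: "'a::field poly"
  assumes H: "H \<subseteq> carrier PGL2" and X: "rf_X \<in> H"
    and fixed: "Fract f g \<in> fixed_field H" and g: "g \<noteq> 0"
    and deg: "Polynomial.degree g < Polynomial.degree f" "Polynomial.degree f = card H"
  shows "fixed_field H = rf_adjoin (Fract f g)"
proof
  let ?K = "rf_adjoin (Fract f g)"
  show "?K \<subseteq> fixed_field H" using H fixed by (rule rf_adjoin_subset_fixed_field)
  define lc where "lc = Polynomial.lead_coeff f"
  define P where "P = Polynomial.smult (rf_const (inverse lc)) (rf_relation f g)"
  have lc: "lc \<noteq> 0" using deg(1) by (auto simp: lc_def)
  have P_deg: "Polynomial.degree P = card H"
    using lc deg by (simp add: P_def degree_rf_relation rf_const_hom)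
  have P_monic: "Polynomial.lead_coeff P = 1"
    using lc degree_rf_relation[OF deg(1)]
    by (simp add: P_def rf_const_hom flip: lc_def rf_const_hom(4))
  have P_over: "poly_over ?K P"
    using poly_over_rf_relation[of f g]
    by (simp add: P_def poly_over_def rf_adjoin_mult rf_const_in_adjoin)
  have P_root: "poly P \<psi> = 0" if "\<psi> \<in> H" for \<psi>
    using poly_rf_relation[OF H fixed g that] by (simp add: P_def)
  \<comment> \<open>Reduction modulo \<open>P\<close> does not change values on \<open>H\<close>,
    since \<open>P\<close> vanishes there.\<close>
  have red: "\<exists>r. poly_over ?K r \<and> Polynomial.degree r < card H \<and> (\<forall>\<psi>\<in>H. poly r \<psi> = poly_at p \<psi>)" for p
  proof -
    have "0 \<in> ?K" using rf_const_in_adjoin[of 0] by (simp add: rf_const_hom)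
    moreover have "Polynomial.degree P > 0" using P_deg deg by simp
    ultimately have "\<exists>r. poly_over ?K r \<and> Polynomial.degree r < Polynomial.degree P \<and>
        P dvd map_poly rf_const p - r"
      using P_over P_monic
      by (intro monic_reduction[of ?K]) (simp_all add: rf_adjoin_diff rf_adjoin_mult poly_over_map_rf_const)
    then obtain r where "poly_over ?K r" "Polynomial.degree r < card H" and dvd: "P dvd map_poly rf_const p - r"
      unfolding P_deg by blast
    moreover have "poly r \<psi> = poly_at p \<psi>" if "\<psi> \<in> H" for \<psi>
    proof -
      from dvd obtain s where "map_poly rf_const p - r = P * s" ..
      then have "poly_at p \<psi> - poly r \<psi> = poly P \<psi> * poly s \<psi>"
        unfolding poly_at_def by (metis poly_diff poly_mult)
      then show ?thesis using P_root[OF that] by simp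
    qed
    ultimately show ?thesis by blast
  qed
  show "fixed_field H \<subseteq> ?K"
  proof
    fix u assume u: "u \<in> fixed_field H"
    obtain A B where AB: "u = Fract A B" "B \<noteq> 0" by (cases u)
    obtain A' where A': "poly_over ?K A'" "Polynomial.degree A' < card H"
      "\<forall>\<psi>\<in>H. poly A' \<psi> = poly_at A \<psi>" using red by blast
    obtain B' where B': "poly_over ?K B'" "Polynomial.degree B' < card H"
      "\<forall>\<psi>\<in>H. poly B' \<psi> = poly_at B \<psi>" using red by blast
    define D where "D = A' - Polynomial.smult u B'"
    have root: "poly D \<psi> = 0" if "\<psi> \<in> H" for \<psi>
      using fixed_field_Fract[OF H _ AB(2) that, of A] u that A'(3) B'(3) AB(1) by (simp add: D_def)
    have "Polynomial.degree D < card H"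
      unfolding D_def using A'(2) B'(2) by (intro degree_diff_less) (auto intro: le_less_trans[OF degree_smult_le])
    have "D = 0"
    proof (rule ccontr)
      assume "D \<noteq> 0"
      then have "card H \<le> card {v. poly D v = 0}"
        using root by (intro card_mono poly_roots_finite) auto
      also have "\<dots> \<le> Polynomial.degree D" using \<open>D \<noteq> 0\<close> by (rule card_poly_roots_bound)
      finally show False using \<open>Polynomial.degree D < card H\<close> by simp
    qed
    then have eq: "A' = Polynomial.smult u B'" by (simp add: D_def)
    \<comment> \<open>At \<open>rf_X\<close> the reduced denominator takes the value
      \<open>B\<close>, so reduction has not made it zero.\<close>
    have "poly B' rf_X \<noteq> 0" using B'(3) X AB(2) by (simp add: poly_at_rf_X_eq_0_iff)
    then have "B' \<noteq> 0" by auto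
    then have "u = Polynomial.lead_coeff A' / Polynomial.lead_coeff B'"
      using eq by simp
    then show "u \<in> ?K"
      using A'(1) B'(1) by (auto simp: poly_over_def intro: rf_adjoin_divide)
  qed
qed

section \<open>Subgroups without nontrivial affine elements\<close>

text \<open>A fraction determines its matrix only up to a scalar, so another representative may
  witness affinity; the quadratic coefficient after cross-multiplication excludes a nonzero
  \<open>c\<close>.\<close>

lemma lin_frac_in_AGL1_iff:
  fixes a b c d :: "'a::field"
  assumes det: "a * d - b * c \<noteq> 0"
  shows "lin_frac a b c d \<in> AGL1 \<longleftrightarrow> c = 0"
proof
  assume "lin_frac a b c d \<in> AGL1"
  then obtain a' b' d' where *: "lin_frac a b c d = lin_frac a' b' 0 d'" "a' \<noteq> 0" "d' \<noteq> 0"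
    by (auto simp: AGL1_def)
  have nz: "[:d, c:] \<noteq> 0" "[:d', 0:] \<noteq> 0" using det *(3) by auto
  have "[:b, a:] * [:d', 0:] = [:b', a':] * [:d, c:]"
    using *(1) unfolding lin_frac_def by (rule eq_fract(1)[OF nz, THEN iffD1])
  then have "a' * c = 0" by auto
  then show "c = 0" using *(2) by simp
next
  assume "c = 0"
  then show "lin_frac a b c d \<in> AGL1"
    unfolding AGL1_def using det by (intro CollectI exI[of _ a] exI[of _ b] exI[of _ c] exI[of _ d]) simp
qed

lemma nonaffineE:
  fixes v :: "'a::field ratfun"
  assumes "v \<in> carrier PGL2 - AGL1"
  obtains a b c d where "v = lin_frac a b c d" "a * d - b * c \<noteq> 0" "c \<noteq> 0"
  using assms by (auto simp: PGL2_def lin_frac_in_AGL1_iff)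

text \<open>A nonaffine map has a denominator of degree 1 and a numerator of degree at most 1, so it
  is bounded at infinity. The product of the denominators serves the whole sum.\<close>

lemma sum_nonaffine:
  fixes T :: "'a::field ratfun set"
  assumes "finite T" "T \<subseteq> carrier PGL2 - AGL1"
  shows "\<exists>A G. \<Sum>T = Fract A G \<and> G \<noteq> 0 \<and>
    Polynomial.degree A \<le> Polynomial.degree G \<and> Polynomial.degree G \<le> card T"
  using assms
proof (induction T)
  case empty
  then show ?case by (intro exI[of _ 0] exI[of _ 1]) (simp add: Zero_fract_def)
next
  case (insert v T)
  then obtain A G where AG: "\<Sum>T = Fract A G" "G \<noteq> 0"
    "Polynomial.degree A \<le> Polynomial.degree G" "Polynomial.degree G \<le> card T" by force
  have "v \<in> carrier PGL2 - AGL1" using insert.prems by blast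
  then obtain a b c d where v: "v = lin_frac a b c d" "c \<noteq> 0" by (rule nonaffineE)
  let ?p = "[:b, a:]" and ?q = "[:d, c:]"
  have "?q \<noteq> 0" using v(2) by simp
  have p: "Polynomial.degree ?p \<le> 1" and q: "Polynomial.degree ?q = 1" using v(2) by auto
  have "\<Sum>(insert v T) = Fract (?p * G + A * ?q) (?q * G)"
    using insert.hyps AG v \<open>?q \<noteq> 0\<close> by (simp add: lin_frac_def del: mult_pCons_left mult_pCons_right)
  moreover have dG: "Polynomial.degree (?q * G) = 1 + Polynomial.degree G"
    using degree_mult_eq[OF \<open>?q \<noteq> 0\<close> AG(2)] q by linarith
  moreover have "Polynomial.degree (?p * G + A * ?q) \<le> 1 + Polynomial.degree G"
    using degree_mult_le[of ?p G] degree_mult_le[of A ?q] p q AG(3) by (intro degree_add_le) linarith+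
  moreover have "?q * G \<noteq> 0" using AG(2) \<open>?q \<noteq> 0\<close> by (simp only: mult_eq_0_iff) simp
  ultimately show ?case
    using insert.hyps AG(4) by (intro exI[of _ "?p * G + A * ?q"] exI[of _ "?q * G"]) simp
qed

text \<open>Substituting an element of \<open>H\<close> multiplies the summands by it on the right,
  which permutes \<open>H\<close>.\<close>

lemma sum_subgroup_fixed:
  assumes H: "subgroup H PGL2"
  shows "\<Sum>H \<in> fixed_field H"
  unfolding fixed_field_def
proof (intro CollectI ballI)
  fix \<psi> assume \<psi>: "\<psi> \<in> H"
  interpret group "PGL2 :: 'a ratfun monoid" by (rule group_PGL2)
  interpret H: subgroup H PGL2 by (rule H)
  interpret E: field_endo "\<lambda>u. rf_comp u \<psi>"
    using \<psi> H.subset by (intro field_endo_rf_comp rf_transcendental_PGL2) auto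
  have "rf_comp (\<Sum>H) \<psi> = (\<Sum>\<chi>\<in>H. \<chi> \<otimes>\<^bsub>PGL2\<^esub> \<psi>)"
    by (simp add: E.sum mult_PGL2)
  also have "\<dots> = \<Sum>H"
    by (rule sum.reindex_bij_witness[of _ "\<lambda>\<chi>. \<chi> \<otimes>\<^bsub>PGL2\<^esub> inv\<^bsub>PGL2\<^esub> \<psi>" "\<lambda>\<chi>. \<chi> \<otimes>\<^bsub>PGL2\<^esub> \<psi>"])
      (use \<psi> in \<open>simp_all add: m_assoc\<close>)
  finally show "rf_comp (\<Sum>H) \<psi> = \<Sum>H" .
qed

text \<open>Affine maps are those that fix infinity. So \<open>rf_X\<close> is the only summand with
  a pole there, which makes the numerator degree exceed the denominator degree.\<close>

theorem fixed_field_nonaffine: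
  fixes H :: "'a::field ratfun set"
  assumes H: "subgroup H PGL2" and fin: "finite H" and aff: "H \<inter> AGL1 \<subseteq> {rf_X}"
  shows "rf_degree (\<Sum>H) = card H" and "fixed_field H = rf_adjoin (\<Sum>H)"
proof -
  interpret H: subgroup H PGL2 by (rule H)
  have X: "rf_X \<in> H" using H.one_closed by (simp add: one_PGL2)
  have "H - {rf_X} \<subseteq> carrier PGL2 - AGL1" using H.subset aff by blast
  then obtain A G where AG: "\<Sum>(H - {rf_X}) = Fract A G" "G \<noteq> 0"
    "Polynomial.degree A \<le> Polynomial.degree G" "Polynomial.degree G \<le> card (H - {rf_X})"
    using sum_nonaffine[of "H - {rf_X}"] fin by auto
  have "\<Sum>H = rf_X + Fract A G" using fin X AG(1) by (simp add: sum.remove)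
  also have "\<dots> = Fract (pCons 0 G + A) G"
    using AG(2) by (simp add: rf_X_def to_fract_def)
  finally have sum: "\<Sum>H = Fract (pCons 0 G + A) G" .
  \<comment> \<open>The degree of \<open>A\<close> is at most that of \<open>G\<close>, so
    \<open>A\<close> cannot affect the leading term of \<open>x * G\<close>.\<close>
  have deg_num: "Polynomial.degree (pCons 0 G + A) = Suc (Polynomial.degree G)"
    using AG(2,3) by (subst degree_add_eq_left) simp_all
  obtain f g k where fgk: "reduced_form (\<Sum>H) f g" "pCons 0 G + A = f * k" "G = g * k"
    unfolding sum using reduced_form_of_Fract[OF AG(2), of "pCons 0 G + A"] by blast
  then have h: "\<Sum>H = Fract f g" and g: "g \<noteq> 0" by (simp_all add: reduced_form_def)
  have nz: "f \<noteq> 0" "k \<noteq> 0" using deg_num fgk(2) by auto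
  \<comment> \<open>Cancelling \<open>k\<close> lowers both degrees by the same amount, which keeps
    their difference 1 and the bound by \<open>card H\<close>.\<close>
  have "Polynomial.degree f + Polynomial.degree k = Suc (Polynomial.degree G)"
    using deg_num nz by (simp add: fgk(2) degree_mult_eq)
  moreover have "Polynomial.degree g + Polynomial.degree k = Polynomial.degree G"
    using g nz by (simp add: fgk(3) degree_mult_eq)
  moreover have "card H = Suc (card (H - {rf_X}))" using fin X by (rule card.remove)
  ultimately have deg: "Polynomial.degree g < Polynomial.degree f" "Polynomial.degree f \<le> card H"
    using AG(4) by linarith+
  have fixed: "Fract f g \<in> fixed_field H" using sum_subgroup_fixed[OF H] h by simp
  \<comment> \<open>The root count supplies the opposite inequality.\<close>
  have eq: "Polynomial.degree f = card H"
    using card_le_degree_fixed[OF H.subset fixed g deg(1)] deg(2) by simp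
  show "rf_degree (\<Sum>H) = card H"
    using rf_degree_eq[OF fgk(1)] deg eq by simp
  show "fixed_field H = rf_adjoin (\<Sum>H)"
    unfolding h using fixed_field_eq_rf_adjoin[OF H.subset X fixed g deg(1) eq] .
qed

text \<open>By Cayley-Hamilton every power of the matrix of \<open>\<phi>\<close> is a linear combination of that matrix and
  the identity.\<close>
lemma lin_frac_pow:
  fixes a b c d :: "'a::field"
  assumes det: "a * d - b * c \<noteq> 0"
  shows "\<exists>s t. lin_frac a b c d [^]\<^bsub>PGL2\<^esub> (i::nat) = lin_frac (s * a + t) (s * b) (s * c) (s * d + t) \<and>
    (s * a + t) * (s * d + t) - (s * b) * (s * c) \<noteq> 0"
proof (induction i)
  case 0
  interpret group "PGL2 :: 'a ratfun monoid" by (rule group_PGL2)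
  show ?case by (intro exI[of _ 0] exI[of _ 1]) (simp add: one_PGL2 rf_X_lin_frac)
next
  case (Suc i)
  interpret group "PGL2 :: 'a ratfun monoid" by (rule group_PGL2)
  from Suc obtain s t where st:
    "lin_frac a b c d [^]\<^bsub>PGL2\<^esub> i = lin_frac (s * a + t) (s * b) (s * c) (s * d + t)"
    "(s * a + t) * (s * d + t) - (s * b) * (s * c) \<noteq> 0" by blast
  \<comment> \<open>For the matrix \<open>M\<close>, Cayley-Hamilton turns
    \<open>(s M + t) M\<close> into \<open>(s tr M + t) M - s det M\<close>.\<close>
  define s' t' where "s' = s * (a + d) + t" and "t' = - s * (a * d - b * c)"
  have "lin_frac a b c d [^]\<^bsub>PGL2\<^esub> Suc i =
      rf_comp (lin_frac (s * a + t) (s * b) (s * c) (s * d + t)) (lin_frac a b c d)"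
    by (simp add: st(1) mult_PGL2)
  also have "\<dots> = lin_frac (s' * a + t') (s' * b) (s' * c) (s' * d + t')"
    unfolding rf_comp_lin_frac[OF st(2) det] by (simp add: s'_def t'_def algebra_simps)
  finally have pow: "lin_frac a b c d [^]\<^bsub>PGL2\<^esub> Suc i = \<dots>" .
  have det': "(s' * a + t') * (s' * d + t') - (s' * b) * (s' * c) =
      ((s * a + t) * (s * d + t) - (s * b) * (s * c)) * (a * d - b * c)"
    by (simp add: s'_def t'_def algebra_simps)
  have "(s' * a + t') * (s' * d + t') - (s' * b) * (s' * c) \<noteq> 0"
    unfolding det' using st(2) det by (rule no_zero_divisors)
  with pow show ?case by blast
qed

text \<open>The lower left entry of the power is \<open>s * c\<close> with \<open>c\<close> nonzero.
  If it vanishes then \<open>s = 0\<close>, so the matrix is scalar and represents the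
  identity.\<close>

lemma lin_frac_pow_affine:
  assumes \<phi>: "\<phi> \<in> carrier PGL2 - AGL1" and aff: "\<phi> [^]\<^bsub>PGL2\<^esub> (i::nat) \<in> AGL1"
  shows "\<phi> [^]\<^bsub>PGL2\<^esub> i = rf_X"
proof -
  obtain a b c d where \<phi>_eq: "\<phi> = lin_frac a b c d" and det: "a * d - b * c \<noteq> 0" and "c \<noteq> 0"
    using \<phi> by (rule nonaffineE)
  obtain s t where st: "\<phi> [^]\<^bsub>PGL2\<^esub> i = lin_frac (s * a + t) (s * b) (s * c) (s * d + t)"
    "(s * a + t) * (s * d + t) - (s * b) * (s * c) \<noteq> 0"
    using lin_frac_pow[OF det, of i] unfolding \<phi>_eq by blast
  have "s * c = 0" using lin_frac_in_AGL1_iff[OF st(2)] aff st(1) by simp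
  then have "s = 0" using \<open>c \<noteq> 0\<close> by simp
  with st have "t \<noteq> 0" "\<phi> [^]\<^bsub>PGL2\<^esub> i = lin_frac t 0 0 t" by simp_all
  then show ?thesis by (simp add: rf_X_lin_frac) (simp add: lin_frac_def eq_fract)
qed

text \<open>The order is positive, so the generated subgroup is finite, and the \<open>r + 1\<close>
  distinct powers exhaust it by counting, negative powers included.\<close>

lemma (in group) bij_betw_pow_generate:
  assumes a: "a \<in> carrier G" and ord: "ord a = Suc r"
  shows "bij_betw (\<lambda>i. a [^] i) {0..r} (generate G {a})"
proof -
  have inj: "inj_on (\<lambda>i. a [^] i) {0..r}" using ord_inj[OF a] ord by simp
  have card: "card (generate G {a}) = Suc r" using generate_pow_card[OF a] ord by simp
  have "(\<lambda>i. a [^] i) ` {0..r} = generate G {a}"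
  proof (rule card_subset_eq)
    show "finite (generate G {a})" using card by (intro card_ge_0_finite) simp
    show "(\<lambda>i. a [^] i) ` {0..r} \<subseteq> generate G {a}"
      using generate_pow[OF a] by (auto simp flip: int_pow_int)
    show "card ((\<lambda>i. a [^] i) ` {0..r}) = card (generate G {a})"
      using card card_image[OF inj] by simp
  qed
  with inj show ?thesis by (simp add: bij_betw_def)
qed

theorem theorem5p4:
  fixes \<phi> h :: "'a::{field, finite} ratfun" and r :: nat
  assumes "\<phi> \<in> carrier PGL2 - AGL1"
    and "group.ord PGL2 \<phi> = r + 1"
    and "h = (\<Sum>i=0..r. \<phi> [^]\<^bsub>PGL2\<^esub> i)"
  shows "rf_degree h = r + 1
    \<and> fixed_field (generate PGL2 {\<phi>}) = rf_adjoin h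
    \<and> galois_extension (rf_adjoin h)"
proof -
  interpret group "PGL2 :: 'a ratfun monoid" by (rule group_PGL2)
  let ?H = "generate PGL2 {\<phi>}"
  have \<phi>: "\<phi> \<in> carrier PGL2" using assms(1) by simp
  have bij: "bij_betw (\<lambda>i. \<phi> [^]\<^bsub>PGL2\<^esub> i) {0..r} ?H"
    using \<phi> assms(2) by (intro bij_betw_pow_generate) simp_all
  have H: "subgroup ?H PGL2" using \<phi> by (intro generate_is_subgroup) simp
  have fin: "finite ?H" and card: "card ?H = r + 1"
    using bij_betw_finite[OF bij] bij_betw_same_card[OF bij] by simp_all
  \<comment> \<open>With exponents from 0 to \<open>r\<close> each element of the subgroup occurs
    exactly once, so \<open>h\<close> is the sum over the subgroup.\<close>
  have h: "h = \<Sum>?H" using sum.reindex_bij_betw[OF bij, of "\<lambda>v. v"] assms(3) by simp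
  have "?H = (\<lambda>i. \<phi> [^]\<^bsub>PGL2\<^esub> i) ` {0..r}" using bij by (simp add: bij_betw_def)
  then have "?H \<inter> AGL1 \<subseteq> {rf_X}"
    using lin_frac_pow_affine[OF assms(1)] by auto
  note fixed_field_nonaffine[OF H fin this]
  with galois_extension_fixed_field[OF H fin] show ?thesis
    by (simp add: h card)
qed

end
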